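(* At each $t=1,2,\ldots$, the algorithm RAM runs in $O\big(|\mathcal V_t|\,(\alpha_t-\beta_t)\,\tau_f\big)$ time, where $\tau_f$ is the time needed for one evaluation of $f$.
   Context: **Setting.** $T\ge 1$ is an integer; $\mathcal V_1,\ldots,\mathcal V_T$ are finite, pairwise disjoint sets; $\mathcal V=\bigcup_{t=1}^T\mathcal V_t$; $f:2^{\mathcal V}\to\mathbb R$ is non-decreasing with $f(\emptyset)=0$; $\alpha_t,\beta_t$ are integers with $0\le\beta_t\le\alpha_t\le|\mathcal V_t|$. For $\mathcal X_s\subseteq\mathcal V_s$, $f(\mathcal X_1,\ldots,\mathcal X_t)$ denotes $f(\mathcal X_1\cup\cdots\cup\mathcal X_t)$, and $f(v)=f(\{v\})$. **Algorithm RAM.** At each $t=1,\ldots,T$, having observed the removals $\mathcal B_s\subseteq\mathcal A_s$, $|\mathcal B_s|\le\beta_s$, for $s\le t-1$: (1) sort $\mathcal V_t=\{v_{t,1},\ldots,v_{t,|\mathcal V_t|}\}$ so that $f(v_{t,1})\ge\cdots\ge f(v_{t,|\mathcal V_t|})$ and set $\mathcal S_{t,1}=\{v_{t,1},\ldots,v_{t,\beta_t}\}$; (2) start from $\mathcal S_{t,2}=\emptyset$ and, while $|\mathcal S_{t,2}|<\alpha_t-\beta_t$, add to $\mathcal S_{t,2}$ an element $x\in\arg\max_{y\in\mathcal V_t\setminus(\mathcal S_{t,1}\cup\mathcal S_{t,2})} f(\mathcal A_1\setminus\mathcal B_1,\ldots,\mathcal A_{t-1}\setminus\mathcal B_{t-1},\mathcal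 S_{t,2}\cup\{y\})$; (3) output $\mathcal A_t=\mathcal S_{t,1}\cup\mathcal S_{t,2}$.
   Formalization: Case α_t=β_t is excluded (the bound is 0 but f is still evaluated). The bound is proved for time spent on evaluations of f; for full time including sorting, only when log|V_t| ≤ K(α_t−β_t)τ_f for a fixed K, as sorting costs |V_t|log|V_t|. One evaluation takes at least one step. *)

theory Defs
  imports Complex_Main "HOL-Library.Landau_Symbols" "HOL-Library.Disjoint_Sets"
begin

text \<open>
  Costed computations: a result, the number of evaluations of the set function, and the number
  of elementary steps.  Every call of one of the list functions below is charged one elementary
  step, which covers the constant amount of comparing, pairing and linking done in its body;
  evaluations of the set function are charged separately by \<open>query\<close>.
\<close>

type_synonym 'r costed = "'r \<times> nat \<times> nat"

definition result :: "'r costed \<Rightarrow> 'r" where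
  "result m = fst m"

definition evals :: "'r costed \<Rightarrow> nat" where
  "evals m = fst (snd m)"

definition steps :: "'r costed \<Rightarrow> nat" where
  "steps m = snd (snd m)"

definition return :: "'r \<Rightarrow> 'r costed" where
  "return x = (x, 0, 0)"

definition bindc :: "'r costed \<Rightarrow> ('r \<Rightarrow> 's costed) \<Rightarrow> 's costed"  (infixr \<open>\<bind>\<close> 54) where
  "m \<bind> k = (let m' = k (result m) in (result m', evals m + evals m', steps m + steps m'))"

definition tick :: "'r costed \<Rightarrow> 'r costed" where
  "tick m = (result m, evals m, Suc (steps m))"

definition query :: "('a set \<Rightarrow> real) \<Rightarrow> 'a set \<Rightarrow> real costed" where
  "query f X = (f X, 1, 0)"


fun singleton_values :: "('a set \<Rightarrow> real) \<Rightarrow> 'a list \<Rightarrow> ('a \<times> real) list costed" where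
  "singleton_values f [] = tick (return [])"
| "singleton_values f (v # vs) =
     tick (query f {v} \<bind> (\<lambda>r. singleton_values f vs \<bind> (\<lambda>ps. return ((v, r) # ps))))"

fun split_at :: "nat \<Rightarrow> 'b list \<Rightarrow> ('b list \<times> 'b list) costed" where
  "split_at 0 xs = tick (return ([], xs))"
| "split_at (Suc n) [] = tick (return ([], []))"
| "split_at (Suc n) (x # xs) = tick (split_at n xs \<bind> (\<lambda>(ys, zs). return (x # ys, zs)))"

fun merge :: "('a \<times> real) list \<Rightarrow> ('a \<times> real) list \<Rightarrow> ('a \<times> real) list costed" where
  "merge [] qs = tick (return qs)"
| "merge (p # ps) [] = tick (return (p # ps))"
| "merge (p # ps) (q # qs) = tick
     (if snd q \<le> snd p then merge ps (q # qs) \<bind> (\<lambda>rs. return (p # rs))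
      else merge (p # ps) qs \<bind> (\<lambda>rs. return (q # rs)))"

text \<open>
  Stable and in non-increasing order of the second components; the first argument is the length of
  the list.
\<close>

fun merge_sort :: "nat \<Rightarrow> ('a \<times> real) list \<Rightarrow> ('a \<times> real) list costed" where
  "merge_sort n ps = tick
     (if n \<le> 1 then return ps
      else split_at (n div 2) ps \<bind> (\<lambda>(ls, rs).
             merge_sort (n div 2) ls \<bind> (\<lambda>ls'.
             merge_sort (n - n div 2) rs \<bind> (\<lambda>rs'.
             merge ls' rs'))))"

declare merge_sort.simps [simp del]

fun elements :: "('a \<times> real) list \<Rightarrow> 'a list costed" where
  "elements [] = tick (return [])"
| "elements (p # ps) = tick (elements ps \<bind> (\<lambda>vs. return (fst p # vs)))"


text \<open>
  Greedy phase.  \<open>best f tie X x r ys\<close> is a maximiser of \<open>f (insert y X)\<close> over \<open>y \<in> {x} \<union> set ys\<close>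
  when \<open>r = f (insert x X)\<close>.  The relation \<open>tie\<close> decides between maximisers; since it is arbitrary,
  every sequence of choices from the argmax sets arises for some \<open>tie\<close>.
\<close>

fun best :: "('a set \<Rightarrow> real) \<Rightarrow> ('a \<Rightarrow> 'a \<Rightarrow> bool) \<Rightarrow> 'a set \<Rightarrow> 'a \<Rightarrow> real \<Rightarrow> 'a list \<Rightarrow> 'a costed" where
  "best f tie X x r [] = tick (return x)"
| "best f tie X x r (y # ys) = tick
     (query f (insert y X) \<bind> (\<lambda>q.
        if r < q \<or> (r = q \<and> tie y x) then best f tie X y q ys else best f tie X x r ys))"

fun delete :: "'a \<Rightarrow> 'a list \<Rightarrow> 'a list costed" where
  "delete x [] = tick (return [])"
| "delete x (y # ys) = tick
     (if x = y then return ys else delete x ys \<bind> (\<lambda>zs. return (y # zs)))"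

text \<open>
  \<open>greedy f tie R k S ys\<close> adds \<open>k\<close> elements to \<open>S\<close>, chosen from the remaining candidates \<open>ys\<close>;
  \<open>R\<close> is the set retained from the earlier stages.
\<close>

fun greedy :: "('a set \<Rightarrow> real) \<Rightarrow> ('a \<Rightarrow> 'a \<Rightarrow> bool) \<Rightarrow> 'a set \<Rightarrow> nat \<Rightarrow> 'a set \<Rightarrow> 'a list \<Rightarrow> 'a set costed" where
  "greedy f tie R 0 S ys = tick (return S)"
| "greedy f tie R (Suc k) S [] = tick (return S)"
| "greedy f tie R (Suc k) S (y # ys) = tick
     (query f (insert y (R \<union> S)) \<bind> (\<lambda>r.
      best f tie (R \<union> S) y r ys \<bind> (\<lambda>x.
      delete x (y # ys) \<bind> (\<lambda>zs.
      greedy f tie R k (insert x S) zs))))"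

definition RAM_stage ::
    "('a set \<Rightarrow> real) \<Rightarrow> ('a \<Rightarrow> 'a \<Rightarrow> bool) \<Rightarrow> 'a set \<Rightarrow> 'a list \<Rightarrow> nat \<Rightarrow> nat \<Rightarrow> 'a set costed" where
  "RAM_stage f tie R vs a b =
     singleton_values f vs \<bind> (\<lambda>ps.
     merge_sort (length vs) ps \<bind> (\<lambda>qs.
     elements qs \<bind> (\<lambda>us.
     split_at b us \<bind> (\<lambda>(S1, cs).
     greedy f tie R (a - b) {} cs \<bind> (\<lambda>S2.
     return (set S1 \<union> S2))))))"


text \<open>
  A problem instance together with everything a run depends on: the order \<open>listing t\<close> in which
  \<open>ground t\<close> is presented, the tie-breaking relation, and the sets \<open>removed t\<close> of removals.
  The field \<open>eval_cost\<close> is the time of one evaluation of \<open>objective\<close>, in units of one elementary step.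
\<close>

record 'a RAM_instance =
  horizon :: nat
  ground :: "nat \<Rightarrow> 'a set"
  objective :: "'a set \<Rightarrow> real"
  alpha :: "nat \<Rightarrow> nat"
  beta :: "nat \<Rightarrow> nat"
  listing :: "nat \<Rightarrow> 'a list"
  tie_break :: "'a \<Rightarrow> 'a \<Rightarrow> bool"
  removed :: "nat \<Rightarrow> 'a set"
  eval_cost :: real

text \<open>
  \<open>retained I t\<close> is the union of the sets that stages \<open>1, \<dots>, t\<close> have output, minus their removals.
\<close>

primrec retained :: "'a RAM_instance \<Rightarrow> nat \<Rightarrow> 'a set" where
  "retained I 0 = {}"
| "retained I (Suc t) = retained I t \<union>
     (result (RAM_stage (objective I) (tie_break I) (retained I t) (listing I (Suc t))
        (alpha I (Suc t)) (beta I (Suc t))) - removed I (Suc t))"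

definition RAM :: "'a RAM_instance \<Rightarrow> nat \<Rightarrow> 'a set costed" where
  "RAM I t = RAM_stage (objective I) (tie_break I) (retained I (t - 1)) (listing I t) (alpha I t) (beta I t)"

definition valid_instance :: "'a RAM_instance \<Rightarrow> bool" where
  "valid_instance I \<longleftrightarrow>
     1 \<le> horizon I \<and>
     (\<forall>t\<in>{1..horizon I}. finite (ground I t)) \<and>
     disjoint_family_on (ground I) {1..horizon I} \<and>
     mono_on (Pow (\<Union>t\<in>{1..horizon I}. ground I t)) (objective I) \<and>
     objective I {} = 0 \<and>
     (\<forall>t\<in>{1..horizon I}. beta I t \<le> alpha I t \<and> alpha I t \<le> card (ground I t)) \<and>
     (\<forall>t\<in>{1..horizon I}. distinct (listing I t) \<and> set (listing I t) = ground I t) \<and>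
     (\<forall>t\<in>{1..horizon I}. removed I t \<subseteq> result (RAM I t) \<and> card (removed I t) \<le> beta I t) \<and>
     1 \<le> eval_cost I"

text \<open>
  Stages with \<open>beta = alpha\<close> are left out: there the product \<open>|ground t| (alpha t - beta t) eval_cost\<close>
  is zero, whereas the singletons are still evaluated.
\<close>

definition stages :: "('a RAM_instance \<times> nat) set" where
  "stages = {(I, t). valid_instance I \<and> t \<in> {1..horizon I} \<and> beta I t < alpha I t}"

definition eval_time :: "'a RAM_instance \<times> nat \<Rightarrow> real" where
  "eval_time = (\<lambda>(I, t). real (evals (RAM I t)) * eval_cost I)"

definition run_time :: "'a RAM_instance \<times> nat \<Rightarrow> real" where
  "run_time = (\<lambda>(I, t). real (evals (RAM I t)) * eval_cost I + real (steps (RAM I t)))"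

end

theory Submission
  imports Defs
begin

text \<open>
  Let \<open>n = |ground t|\<close> and \<open>k = alpha t - beta t\<close>.  The singletons cost \<open>n\<close> evaluations and each of
  the \<open>k\<close> greedy rounds at most \<open>n\<close>, so \<open>n + k n\<close> in all.  Apart from merge sort every phase takes
  \<open>O(n k)\<close> elementary steps.  Merge sort takes \<open>O(n (1 + log 2 n))\<close> steps and no evaluations; the
  hypothesis \<open>log 2 n \<le> K k eval_cost\<close> absorbs the logarithm.
\<close>

text \<open>With these rules the simplifier adds up the cost of a program, so no later proof unfolds
  the triples.\<close>

lemma costed_simps [simp]:
  "result (return x) = x" "evals (return x) = 0" "steps (return x) = 0"
  "result (tick m) = result m" "evals (tick m) = evals m" "steps (tick m) = Suc (steps m)"
  "result (query f X) = f X" "evals (query f X) = 1" "steps (query f X) = 0"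
  "result (m \<bind> h) = result (h (result m))"
  "evals (m \<bind> h) = evals m + evals (h (result m))"
  "steps (m \<bind> h) = steps m + steps (h (result m))"
  by (simp_all add: result_def evals_def steps_def return_def tick_def query_def bindc_def Let_def)

lemma singleton_values_cost [simp]:
  "length (result (singleton_values f vs)) = length vs"
  "evals (singleton_values f vs) = length vs"
  "steps (singleton_values f vs) = Suc (length vs)"
  by (induction vs) simp_all

lemma split_at_cost [simp]:
  "result (split_at n xs) = (take n xs, drop n xs)"
  "evals (split_at n xs) = 0"
  "steps (split_at n xs) = Suc (min n (length xs))"
  by (induction n xs rule: split_at.induct) simp_all

lemma length_merge [simp]: "length (result (merge ps qs)) = length ps + length qs"
  by (induction ps qs rule: merge.induct) simp_all

lemma evals_merge [simp]: "evals (merge ps qs) = 0"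
  by (induction ps qs rule: merge.induct) simp_all

lemma steps_merge: "steps (merge ps qs) \<le> Suc (length ps + length qs)"
  by (induction ps qs rule: merge.induct) simp_all

lemma length_merge_sort [simp]: "length (result (merge_sort n ps)) = length ps"
  \<comment> \<open>The defining equation is unconditional and may loop as a simp rule;
    \<open>subst\<close> unfolds it once.\<close>
  by (induction n ps rule: merge_sort.induct) (subst merge_sort.simps, auto)

lemma evals_merge_sort [simp]: "evals (merge_sort n ps) = 0"
  by (induction n ps rule: merge_sort.induct) (subst merge_sort.simps, simp)

text \<open>The summand \<open>3\<close> strengthens the bound so that it survives the constant overhead of a split.\<close>

lemma steps_merge_sort:
  assumes "length ps = n" "1 \<le> n" "n \<le> 2 ^ m"
  shows "steps (merge_sort n ps) + 3 \<le> 2 * n * m + 4 * n"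
  using assms
proof (induction m arbitrary: n ps)
  case 0
  \<comment> \<open>Here \<open>n = 1\<close>, and the single step plus \<open>3\<close> meets the
    bound \<open>4 * n\<close> exactly.\<close>
  then show ?case by (simp add: merge_sort.simps)
next
  case (Suc m)
  show ?case
  proof (cases "n \<le> 1")
    case True
    with Suc.prems show ?thesis by (simp add: merge_sort.simps)
  next
    case False
    define l where "l = n div 2"
    define r where "r = n - l"
    have n: "n = l + r" and bounds: "1 \<le> l" "l \<le> r" "r \<le> 2 ^ m"
      using False Suc.prems unfolding l_def r_def by auto
    let ?ls = "take l ps" and ?rs = "drop l ps"
    have "steps (merge_sort n ps) =
        2 + l + steps (merge_sort l ?ls) + steps (merge_sort r ?rs)
        + steps (merge (result (merge_sort l ?ls)) (result (merge_sort r ?rs)))"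
      using False Suc.prems by (subst merge_sort.simps) (simp add: l_def r_def)
    moreover have "steps (merge (result (merge_sort l ?ls)) (result (merge_sort r ?rs))) \<le> Suc n"
      using steps_merge[of "result (merge_sort l ?ls)" "result (merge_sort r ?rs)"] n Suc.prems
      by simp
    moreover have "steps (merge_sort l ?ls) + 3 \<le> 2 * l * m + 4 * l"
      using bounds n Suc.prems by (intro Suc.IH) auto
    moreover have "steps (merge_sort r ?rs) + 3 \<le> 2 * r * m + 4 * r"
      using bounds n Suc.prems by (intro Suc.IH) auto
    moreover have "2 * n * Suc m = 2 * l * m + 2 * r * m + 2 * l + 2 * r"
      by (simp add: n algebra_simps)
    \<comment> \<open>This level adds at most \<open>l + n + 3\<close> steps. Raising
      \<open>m\<close> by one pays \<open>2 * n\<close>, which covers \<open>l + n\<close>; the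
      halves carry two spare summands \<open>3\<close>, the whole only one, and the difference
      covers the rest.\<close>
    ultimately show ?thesis
      using bounds n by linarith
  qed
qed

text \<open>Rounding the logarithm up to an integer \<open>m\<close> adds at most one, which turns
  \<open>4 * n\<close> into \<open>6 * n\<close>.\<close>

lemma steps_merge_sort_log:
  assumes "length ps = n" "1 \<le> n"
  shows "real (steps (merge_sort n ps)) \<le> 2 * real n * log 2 (real n) + 6 * real n"
proof -
  define m where "m = nat \<lceil>log 2 (real n)\<rceil>"
  have log0: "0 \<le> log 2 (real n)"
    using assms by simp
  have m: "log 2 (real n) \<le> real m" "real m \<le> log 2 (real n) + 1"
    unfolding m_def using log0 by linarith+
  have "real n \<le> 2 powr real m"
    using m(1) assms by (simp add: log_le_iff)
  then have "n \<le> 2 ^ m"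
    by (simp add: powr_realpow)
  then have "steps (merge_sort n ps) \<le> 2 * n * m + 4 * n"
    using steps_merge_sort[OF assms] by force
  then have "real (steps (merge_sort n ps)) \<le> 2 * real n * real m + 4 * real n"
    by (metis (mono_tags, lifting) of_nat_add of_nat_le_iff of_nat_mult of_nat_numeral)
  also have "\<dots> \<le> 2 * real n * (log 2 (real n) + 1) + 4 * real n"
    using m(2) by (intro add_mono mult_left_mono) auto
  finally show ?thesis by (simp add: algebra_simps)
qed

lemma elements_cost [simp]:
  "length (result (elements ps)) = length ps"
  "evals (elements ps) = 0"
  "steps (elements ps) = Suc (length ps)"
  by (induction ps) simp_all

text \<open>Both branches recurse on the same tail, so the cost is the same whatever the comparisons
  and \<open>tie\<close> decide.\<close>

lemma best_cost [simp]:
  "evals (best f tie X x r ys) = length ys"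
  "steps (best f tie X x r ys) = Suc (length ys)"
  by (induction ys arbitrary: x r) simp_all

lemma length_delete_le: "length (result (delete x ys)) \<le> length ys"
  by (induction ys) simp_all

lemma evals_delete [simp]: "evals (delete x ys) = 0"
  by (induction ys) simp_all

lemma steps_delete: "steps (delete x ys) \<le> Suc (length ys)"
  by (induction ys) simp_all

text \<open>Since \<open>delete\<close> never lengthens the list, \<open>n\<close> bounds the
  candidates in every round. A round takes one step for the call, at most \<open>n\<close> for
  \<open>best\<close> and \<open>n + 1\<close> for \<open>delete\<close>; the final \<open>1\<close>
  is the terminating call.\<close>

lemma greedy_cost:
  assumes "length ys \<le> n"
  shows "evals (greedy f tie R k S ys) \<le> k * n"
    and "steps (greedy f tie R k S ys) \<le> k * (2 * n + 2) + 1"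
proof -
  have "evals (greedy f tie R k S ys) \<le> k * n \<and>
      steps (greedy f tie R k S ys) \<le> k * (2 * n + 2) + 1"
    using assms
  proof (induction k arbitrary: S ys)
    case 0
    then show ?case by simp
  next
    case (Suc k)
    show ?case
    proof (cases ys)
      case Nil
      then show ?thesis by simp
    next
      case (Cons y zs)
      define x where "x = result (best f tie (R \<union> S) y (f (insert y (R \<union> S))) zs)"
      define ws where "ws = result (delete x ys)"
      have "length ws \<le> n"
        unfolding ws_def using Suc.prems length_delete_le[of x ys] by linarith
      note IH = Suc.IH[OF this, of "insert x S"]
      \<comment> \<open>The query for \<open>y\<close> and those of \<open>best\<close> on
        \<open>zs\<close> make one evaluation per candidate.\<close>
      have "evals (greedy f tie R (Suc k) S ys) = length ys + evals (greedy f tie R k (insert x S) ws)"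
        unfolding Cons ws_def x_def by (simp del: delete.simps)
      moreover have "steps (greedy f tie R (Suc k) S ys) =
          1 + length ys + steps (delete x ys) + steps (greedy f tie R k (insert x S) ws)"
        unfolding Cons ws_def x_def by (simp del: delete.simps)
      ultimately show ?thesis
        using IH Suc.prems steps_delete[of x ys] by simp
    qed
  qed
  then show "evals (greedy f tie R k S ys) \<le> k * n"
    and "steps (greedy f tie R k S ys) \<le> k * (2 * n + 2) + 1"
    by blast+
qed

lemma evals_RAM_stage: "evals (RAM_stage f tie R vs a b) \<le> length vs + (a - b) * length vs"
  unfolding RAM_stage_def by (simp add: greedy_cost(1))

lemma steps_RAM_stage:
  assumes "vs \<noteq> []"
  shows "real (steps (RAM_stage f tie R vs a b)) \<le>
    2 * real (length vs) * log 2 (real (length vs)) + 9 * real (length vs)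
    + real (a - b) * (2 * real (length vs) + 2) + 4"
proof -
  define n where "n = length vs"
  define ps where "ps = result (singleton_values f vs)"
  define us where "us = result (elements (result (merge_sort n ps)))"
  have len: "length ps = n" "length us = n"
    unfolding us_def ps_def n_def by simp_all
  \<comment> \<open>The \<open>3\<close> counts the closing calls of
    \<open>singleton_values\<close>, \<open>elements\<close> and \<open>split_at\<close>.\<close>
  have "steps (RAM_stage f tie R vs a b) = 3 + 2 * n + min b n + steps (merge_sort n ps)
      + steps (greedy f tie R (a - b) {} (drop b us))"
    unfolding RAM_stage_def using len by (simp add: n_def us_def ps_def)
  also have "\<dots> \<le> 3 * n + steps (merge_sort n ps) + (a - b) * (2 * n + 2) + 4"
    using greedy_cost(2)[of "drop b us" n f tie R "a - b" "{}"] len by simp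
  finally have "real (steps (RAM_stage f tie R vs a b)) \<le>
      real (3 * n + steps (merge_sort n ps) + (a - b) * (2 * n + 2) + 4)"
    by (rule of_nat_mono)
  also have "\<dots> = 3 * real n + real (steps (merge_sort n ps)) + real (a - b) * (2 * real n + 2) + 4"
    by (simp add: distrib_left)
  also have "real (steps (merge_sort n ps)) \<le> 2 * real n * log 2 (real n) + 6 * real n"
    using assms len by (intro steps_merge_sort_log) (auto simp: n_def Suc_le_eq)
  finally show ?thesis by (simp add: n_def)
qed

context
  fixes I :: "'a RAM_instance" and t :: nat and n k c :: real
  assumes stage: "(I, t) \<in> stages"
  defines "n \<equiv> real (card (ground I t))"
    and "k \<equiv> real (alpha I t - beta I t)"
    and "c \<equiv> eval_cost I"
begin

lemma length_listing: "length (listing I t) = card (ground I t)"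
proof -
  have "distinct (listing I t)" "set (listing I t) = ground I t"
    using stage by (auto simp: stages_def valid_instance_def)
  then show ?thesis by (metis distinct_card)
qed

text \<open>The strict inequality in \<open>stages\<close> forces \<open>k \<ge> 1\<close> and,
  through \<open>alpha I t \<le> card (ground I t)\<close>, also \<open>n \<ge> 1\<close>. These
  bounds let lower-order terms be absorbed into \<open>n * k * c\<close>.\<close>

lemma stage_bounds: "1 \<le> n" "1 \<le> k" "1 \<le> c"
proof -
  have "beta I t < alpha I t" "alpha I t \<le> card (ground I t)" "1 \<le> eval_cost I"
    using stage by (auto simp: stages_def valid_instance_def)
  then show "1 \<le> n" "1 \<le> k" "1 \<le> c"
    by (auto simp: n_def k_def c_def)
qed

text \<open>As \<open>k \<ge> 1\<close>, the singletons and the greedy rounds each contribute at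
  most \<open>n * k\<close> evaluations.\<close>

lemma eval_time_le: "eval_time (I, t) \<le> 2 * (n * k * c)"
proof -
  have "real (evals (RAM I t)) \<le> real (card (ground I t) + (alpha I t - beta I t) * card (ground I t))"
    unfolding RAM_def length_listing[symmetric] by (intro of_nat_mono evals_RAM_stage)
  also have "\<dots> = n + k * n"
    by (simp add: n_def k_def)
  also have "\<dots> \<le> 2 * (n * k)"
    using stage_bounds mult_left_mono[of 1 k n] by (simp add: mult.commute)
  finally have "real (evals (RAM I t)) * c \<le> 2 * (n * k) * c"
    using stage_bounds by (intro mult_right_mono) auto
  then show ?thesis
    by (simp add: eval_time_def c_def mult.assoc)
qed

lemma steps_RAM_le:
  assumes "log 2 n \<le> K * k * c"
  shows "real (steps (RAM I t)) \<le> (2 * K + 17) * (n * k * c)"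
proof -
  have "listing I t \<noteq> []"
    using length_listing stage_bounds(1) by (auto simp: n_def)
  then have "real (steps (RAM I t)) \<le> 2 * n * log 2 n + 9 * n + k * (2 * n + 2) + 4"
    using steps_RAM_stage[of "listing I t"] unfolding RAM_def length_listing n_def k_def by blast
  \<comment> \<open>The sorting term yields \<open>2 * K\<close>. The terms \<open>9 * n\<close>,
    \<open>2 * n * k\<close>, \<open>2 * k\<close> and \<open>4\<close> are bounded by multiples of
    \<open>n * k\<close>, and \<open>9 + 2 + 2 + 4 = 17\<close>.\<close>
  also have "n * log 2 n \<le> n * (K * k * c)"
    using assms stage_bounds by (intro mult_left_mono) auto
  moreover have "n \<le> n * k" "k \<le> n * k" "1 \<le> n * k"
    using stage_bounds mult_mono[of 1 n 1 k] by auto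
  moreover have "n * k \<le> n * k * c"
    using stage_bounds by simp
  ultimately show ?thesis
    by (simp add: algebra_simps)
qed

lemma run_time_le:
  assumes "log 2 n \<le> K * k * c"
  shows "run_time (I, t) \<le> (2 * K + 19) * (n * k * c)"
  using eval_time_le steps_RAM_le[OF assms]
  by (simp add: run_time_def eval_time_def algebra_simps)

lemma time_nonneg: "0 \<le> eval_time (I, t)" "0 \<le> run_time (I, t)" "0 \<le> n * k * c"
  using stage_bounds by (auto simp: eval_time_def run_time_def c_def)

end

theorem proposition2:
  shows "eval_time \<in> O[principal (stages :: ('a RAM_instance \<times> nat) set)](\<lambda>(I, t).
      real (card (ground I t)) * real (alpha I t - beta I t) * eval_cost I) \<and>
    (\<forall>K::real. run_time \<in> O[principal {(I, t) \<in> (stages :: ('a RAM_instance \<times> nat) set).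
        log 2 (real (card (ground I t))) \<le> K * real (alpha I t - beta I t) * eval_cost I}](\<lambda>(I, t).
      real (card (ground I t)) * real (alpha I t - beta I t) * eval_cost I))"
proof (intro conjI allI)
  show "eval_time \<in> O[principal (stages :: ('a RAM_instance \<times> nat) set)](\<lambda>(I, t).
      real (card (ground I t)) * real (alpha I t - beta I t) * eval_cost I)"
  \<comment> \<open>Over a principal filter \<open>eventually\<close> means everywhere on the set,
    so one constant must serve all pairs in \<open>stages\<close>.\<close>
  proof (rule bigoI[where c = 2], unfold eventually_principal, safe)
    fix I :: "'a RAM_instance" and t assume "(I, t) \<in> stages"
    from eval_time_le[OF this] time_nonneg[OF this]
    show "norm (eval_time (I, t)) \<le>
        2 * norm (real (card (ground I t)) * real (alpha I t - beta I t) * eval_cost I)"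
      unfolding real_norm_def by linarith
  qed
next
  fix K :: real
  show "run_time \<in> O[principal {(I, t) \<in> (stages :: ('a RAM_instance \<times> nat) set).
        log 2 (real (card (ground I t))) \<le> K * real (alpha I t - beta I t) * eval_cost I}](\<lambda>(I, t).
      real (card (ground I t)) * real (alpha I t - beta I t) * eval_cost I)"
  \<comment> \<open>The constant depends on \<open>K\<close> only. For negative \<open>K\<close> the
    set is empty, because the logarithm is nonnegative on \<open>stages\<close>;
    \<open>bigoI\<close> accepts a constant of any sign, so no case split arises.\<close>
  proof (rule bigoI[where c = "2 * K + 19"], unfold eventually_principal, safe)
    fix I :: "'a RAM_instance" and t
    assume stage: "(I, t) \<in> stages"
      and log: "log 2 (real (card (ground I t))) \<le> K * real (alpha I t - beta I t) * eval_cost I"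
    from run_time_le[OF stage log] time_nonneg[OF stage]
    show "norm (run_time (I, t)) \<le>
        (2 * K + 19) * norm (real (card (ground I t)) * real (alpha I t - beta I t) * eval_cost I)"
      by (simp only: real_norm_def abs_of_nonneg)
  qed
qed

end
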